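(* Let $q$ be a prime power and $m_1,n_1,m_2,n_2\in\{1,\dots,q-1\}$. Suppose there exists an integer $k$ with $\gcd(k,q-1)=1$ such that $m_2\equiv km_1 \pmod{q-1}$ and $n_2\equiv kn_1\pmod{q-1}$. Then $D(q;m_1,n_1)\cong D(q;m_2,n_2)$.
   Context: $\mathbb{F}_q$ is the field with $q$ elements. For integers $1\le m,n\le q-1$, the monomial digraph $D(q;m,n)$ has vertex set $\mathbb{F}_q^2$, and $((x_1,x_2),(y_1,y_2))$ is an arc iff $x_2+y_2=x_1^m y_1^n$. $\cong$ denotes digraph isomorphism. *)

theory Defs
  imports
    "Graph_Theory.Pair_Digraph"
    "Graph_Theory.Digraph_Isomorphism"
    "HOL-Library.Cardinality"
    "HOL-Number_Theory.Number_Theory"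
begin

text \<open>The field is the type \<open>'a\<close>; for a finite field, \<open>q\<close> is \<open>CARD('a)\<close>.\<close>

definition monomial_digraph :: "nat \<Rightarrow> nat \<Rightarrow> ('a::field \<times> 'a) pair_pre_digraph" where
  "monomial_digraph m n =
    \<lparr> pverts = UNIV,
      parcs = {((x1, x2), (y1, y2)) | x1 x2 y1 y2. x2 + y2 = x1 ^ m * y1 ^ n} \<rparr>"

end

theory Submission
  imports Defs
begin

text \<open>Exponents of the finite field matter only modulo \<open>q - 1\<close>, as long as they are positive.
  If \<open>j\<close> is a positive inverse of \<open>k\<close> modulo \<open>q - 1\<close>, then \<open>x \<mapsto> x ^ j\<close> permutes the field and
  \<open>(x ^ j) ^ m2 = x ^ m1\<close>, \<open>(y ^ j) ^ n2 = y ^ n1\<close>. Hence \<open>(x, y) \<mapsto> (x ^ j, y)\<close> is an isomorphism.\<close>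

text \<open>Arcs of a pair digraph are pairs of vertices, so a vertex map determines the whole
  isomorphism record: \<open>map_prod f f\<close> acts on arcs and the projections stay tail and
  head.\<close>

lemma digraph_iso_with_projI:
  assumes "pair_wf_digraph G"
    and bij: "bij_betw f (pverts G) (pverts H)"
    and arcs: "parcs H = map_prod f f ` parcs G"
  shows "digraph_iso (with_proj G) (with_proj H)"
proof -
  interpret pair_wf_digraph G by fact
  define h where "h = \<lparr>iso_verts = f, iso_arcs = map_prod f f, iso_head = snd, iso_tail = fst\<rparr>"
  have inj: "inj_on f (pverts G)" and im: "f ` pverts G = pverts H"
    using bij by (auto simp: bij_betw_def)
  have "parcs G \<subseteq> pverts G \<times> pverts G"
    using in_arcsD1 in_arcsD2 by fastforce
  then have "inj_on (map_prod f f) (parcs G)"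
    using map_prod_inj_on[OF inj inj] inj_on_subset by blast
  then have "pre_digraph.digraph_isomorphism (with_proj G) h"
    using inj assms(1)
    by (auto simp: pre_digraph.digraph_isomorphism_def h_def wf_digraph_wp_iff)
  moreover have "with_proj H = app_iso h (with_proj G)"
    by (simp add: app_iso_def h_def with_proj_def im arcs)
  ultimately show ?thesis
    unfolding digraph_iso_def by blast
qed

text \<open>Multiplication by \<open>x\<close> permutes the nonzero elements, so their product is
  unchanged when each factor is multiplied by \<open>x\<close>; cancelling this nonzero product
  gives the claim.\<close>

lemma finite_field_power_card_minus_1:
  fixes x :: "'a::{field, finite}"
  assumes "x \<noteq> 0"
  shows "x ^ (CARD('a) - 1) = 1"
proof -
  let ?U = "UNIV - {0::'a}"
  have "(*) x ` ?U = ?U"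
  proof (intro equalityI subsetI)
    fix y assume "y \<in> ?U"
    then show "y \<in> (*) x ` ?U"
      using assms by (intro image_eqI[of _ _ "y / x"]) auto
  qed (use assms in auto)
  moreover have "inj_on ((*) x) ?U"
    using assms by (auto simp: inj_on_def)
  ultimately have "\<Prod>?U = (\<Prod>y\<in>?U. x * y)"
    using prod.reindex[of "(*) x" ?U "\<lambda>y. y"] by simp
  also have "\<dots> = x ^ (CARD('a) - 1) * \<Prod>?U"
    by (simp add: prod.distrib card_Diff_singleton)
  finally show ?thesis
    by (simp add: prod_zero_iff)
qed

text \<open>Positivity of the exponents handles \<open>x = 0\<close>, where exponent 0 would give 1
  instead of 0.\<close>

lemma finite_field_power_cong:
  fixes x :: "'a::{field, finite}"
  assumes "[a = b] (mod (CARD('a) - 1))" and "a > 0" and "b > 0"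
  shows "x ^ a = x ^ b"
proof (cases "x = 0")
  case False
  \<comment> \<open>Congruent naturals become equal once suitable multiples of the modulus are added
    to both, and such additions do not change the power.\<close>
  have "x ^ (c + (CARD('a) - 1) * d) = x ^ c" for c d
    by (simp only: power_add power_mult finite_field_power_card_minus_1[OF False] power_one mult_1_right)
  then show ?thesis
    using assms(1) unfolding cong_iff_lin_nat by (metis mult.commute)
qed (use assms(2,3) in \<open>simp add: zero_power\<close>)

text \<open>The \<open>k\<close>-th power undoes the \<open>j\<close>-th, which gives injectivity;
  finiteness then gives surjectivity.\<close>

lemma bij_finite_field_power:
  fixes j k :: nat
  assumes "[j * k = 1] (mod (CARD('a::{field, finite}) - 1))" and "j > 0" and "k > 0"
  shows "bij (\<lambda>x::'a. x ^ j)"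
proof -
  have "(x ^ j) ^ k = x" for x :: 'a
    using finite_field_power_cong[OF assms(1), of x] assms(2,3) by (simp add: power_mult)
  then have "inj (\<lambda>x::'a. x ^ j)"
    by (metis injI)
  then show ?thesis
    by (simp add: bij_betw_def finite_UNIV_inj_surj)
qed

lemma monomial_digraph_isoI:
  fixes j m1 n1 m2 n2 :: nat
  assumes bij: "bij (\<lambda>x::'a::field. x ^ j)"
    and m: "\<And>x::'a. x ^ (j * m2) = x ^ m1"
    and n: "\<And>x::'a. x ^ (j * n2) = x ^ n1"
  shows "digraph_iso
           (with_proj (monomial_digraph m1 n1 :: ('a \<times> 'a) pair_pre_digraph))
           (with_proj (monomial_digraph m2 n2 :: ('a \<times> 'a) pair_pre_digraph))"
proof (rule digraph_iso_with_projI)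
  let ?f = "map_prod (\<lambda>x::'a. x ^ j) (\<lambda>y::'a. y)"
  let ?G = "monomial_digraph m1 n1 :: ('a \<times> 'a) pair_pre_digraph"
  let ?H = "monomial_digraph m2 n2 :: ('a \<times> 'a) pair_pre_digraph"
  show "pair_wf_digraph ?G"
    by unfold_locales (auto simp: monomial_digraph_def)
  have bij_f: "bij ?f"
    using bij_betw_map_prod[OF bij bij_id[unfolded id_def]] by simp
  then show "bij_betw ?f (pverts ?G) (pverts ?H)"
    by (simp add: monomial_digraph_def)
  have arc_iff: "map_prod ?f ?f e \<in> parcs ?H \<longleftrightarrow> e \<in> parcs ?G" for e
    by (cases e) (auto simp: monomial_digraph_def m n simp flip: power_mult)
  \<comment> \<open>\<open>arc_iff\<close> describes the arcs of \<open>?G\<close> as a preimage;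
    surjectivity turns this into the required image.\<close>
  have "surj (map_prod ?f ?f)"
    using map_prod_surj[OF bij_is_surj[OF bij_f] bij_is_surj[OF bij_f]] .
  then have "map_prod ?f ?f ` (map_prod ?f ?f -` parcs ?H) = parcs ?H"
    by (rule surj_image_vimage_eq)
  moreover have "map_prod ?f ?f -` parcs ?H = parcs ?G"
    using arc_iff by blast
  ultimately show "parcs ?H = map_prod ?f ?f ` parcs ?G"
    by simp
qed

lemma ex_pos_nat_cong_int:
  fixes a :: int and N :: nat
  assumes "N > 0"
  obtains b :: nat where "b > 0" and "[int b = a] (mod int N)"
proof
  \<comment> \<open>Adding \<open>N\<close> keeps the witness positive even when the residue is
    0.\<close>
  show "nat (a mod int N) + N > 0"
    using assms by simp
  show "[int (nat (a mod int N) + N) = a] (mod int N)"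
    using assms by (simp add: cong_def)
qed

theorem theorem5:
  fixes q m1 n1 m2 n2 :: nat
  assumes "primepow q"
    and "CARD('a::{field, finite}) = q"
    and "m1 \<in> {1..q - 1}" and "n1 \<in> {1..q - 1}"
    and "m2 \<in> {1..q - 1}" and "n2 \<in> {1..q - 1}"
    and "\<exists>k::int. gcd k (int q - 1) = 1 \<and>
           [int m2 = k * int m1] (mod (int q - 1)) \<and>
           [int n2 = k * int n1] (mod (int q - 1))"
  shows "digraph_iso
           (with_proj (monomial_digraph m1 n1 :: ('a \<times> 'a) pair_pre_digraph))
           (with_proj (monomial_digraph m2 n2 :: ('a \<times> 'a) pair_pre_digraph))"
proof -
  define N where "N = q - 1"
  \<comment> \<open>A nonempty exponent range forces \<open>q\<close> \<ge> 2, so natural and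
    integer subtraction agree.\<close>
  have "N > 0" and N: "int q - 1 = int N"
    using assms(3) by (auto simp: N_def)
  obtain k where "coprime k (int N)"
    and km: "[int m2 = k * int m1] (mod int N)"
    and kn: "[int n2 = k * int n1] (mod int N)"
    using assms(7) by (auto simp: N coprime_iff_gcd_eq_1)
  then obtain i where i: "[k * i = 1] (mod int N)"
    using cong_solve_coprime_int by blast
  obtain j where "j > 0" and j: "[int j = i] (mod int N)"
    using ex_pos_nat_cong_int[OF \<open>N > 0\<close>] by blast
  \<comment> \<open>The integer \<open>k\<close> may be negative; \<open>l\<close> stands in for it
    as the exponent inverting the \<open>j\<close>-th power.\<close>
  obtain l where "l > 0" and l: "[int l = k] (mod int N)"
    using ex_pos_nat_cong_int[OF \<open>N > 0\<close>] by blast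
  have jk: "[int j * k = 1] (mod int N)"
    using cong_trans[OF cong_scalar_right[OF j, of k]] i by (simp add: mult.commute)
  have "[int (j * l) = int 1] (mod int N)"
    using cong_trans[OF cong_scalar_left[OF l, of "int j"] jk] by simp
  then have "[j * l = 1] (mod (CARD('a) - 1))"
    by (simp only: cong_int_iff assms(2) N_def)
  then have "bij (\<lambda>x::'a. x ^ j)"
    using bij_finite_field_power \<open>j > 0\<close> \<open>l > 0\<close> by blast
  \<comment> \<open>To be used for \<open>a\<close>, \<open>b\<close> equal to \<open>m1\<close>,
    \<open>m2\<close> and to \<open>n1\<close>, \<open>n2\<close>: modulo \<open>N\<close>,
    \<open>j * b\<close> is \<open>j * k * a\<close>, hence \<open>a\<close>.\<close>
  moreover have "x ^ (j * b) = x ^ a"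
    if "[int b = k * int a] (mod int N)" "a > 0" "b > 0" for a b and x :: 'a
  proof (rule finite_field_power_cong)
    have "[int j * int b = int j * k * int a] (mod int N)"
      using cong_scalar_left[OF that(1), of "int j"] by (simp add: mult.assoc)
    also have "[int j * k * int a = int a] (mod int N)"
      using cong_scalar_right[OF jk, of "int a"] by simp
    finally have "[int (j * b) = int a] (mod int N)"
      by simp
    then show "[j * b = a] (mod (CARD('a) - 1))"
      by (simp only: cong_int_iff assms(2) N_def)
  qed (use that \<open>j > 0\<close> in auto)
  ultimately show ?thesis
    using km kn assms(3-6) by (intro monomial_digraph_isoI[of j]) auto
qed

end
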